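(* Let $p$ be an odd prime, let $1\le d\le p-1$, $i\ge 1$, $k\ge1$, $0\le s_1<\cdots<s_k<n$ be integers, and set $s_0=0$. Then $\mathrm{St}^{\Delta_i}M^{(d)}_{n,s_1,\ldots,s_k}$ equals $$\begin{cases} (-1)^{s_t-t}M^{(d)}_{n,s_0,\ldots,\hat s_t,\ldots,s_k}, & s_1>0,\ i=s_t,\ 1\le t\le k,\\[4pt] (-1)^{n-1}(d-1)M_{n,s_1,\ldots,s_k}[1,2,\ldots,n-1,i]L_n^{d-2}, & i\ge n,\ s_1=0,\\[4pt] (-1)^{n-1}\Big((-1)^k[k;1,\ldots,\hat s_1,\ldots,\hat s_k,\ldots,n-1,i]L_n^{d-1}\\ \qquad\qquad+(d-1)M_{n,s_1,\ldots,s_k}[1,2,\ldots,n-1,i]L_n^{d-2}\Big), & i\ge n,\ s_1>0,\\[4pt] 0, & \text{otherwise.} \end{cases}$$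
   Context: $P_n=E(x_1,\ldots,x_n)\otimes\mathbb F_p[y_1,\ldots,y_n]$ (exterior tensor polynomial algebra), graded by $\dim x_j=1$, $\dim y_j=2$, with the usual action of the mod $p$ Steenrod algebra $\mathcal A(p)$. For $i\ge1$, $\mathrm{St}^{\Delta_i}\in\mathcal A(p)$ is the primitive Steenrod–Milnor operation dual to $\xi_i$ with respect to the Milnor monomial basis of $\mathcal A(p)^*$. By the Cartan formula its action on $P_n$ is the $\mathbb F_p$-linear derivation determined by $\mathrm{St}^{\Delta_i}(x_j)=0$, $\mathrm{St}^{\Delta_i}(y_j)=y_j^{p^i}$. For nonnegative integers $e_1,\ldots,e_m$, $[e_1,\ldots,e_m]=\det\big(y_a^{p^{e_b}}\big)_{1\le a,b\le m}$ (and $[\emptyset]=1$). For $0\le k\le n$ and nonnegative integers $e_{k+1},\ldots,e_n$, the element $[k;e_{k+1},\ldots,e_n]\in P_n$ is $\frac1{k!}$ times the $n\times n$ determinant whose first $k$ rows are all $(x_1,\ldots,x_n)$ and whose following rows are $(y_1^{p^{e_j}},\ldots,y_n^{p^{e_j}})$, $j=k+1,\ldots,n$; its precise meaning is the Laplace expansion $$[k;e_{k+1},\ldots,e_n]=\sum_{I}\operatorname{sign}(\sigma_I)\,x_{i_1}\cdots x_{i_k}\,[e_{k+1},\ldots,e_n](y_{i_{k+1}},\ldots,y_{i_n}),$$ the sum being over all $I=\{i_1<\cdots<i_k\}\subset\{1,\ldots,n\}$ with complement $\{i_{k+1}<\cdots<i_n\}$, where $\sigma_I$ is the permutation $j\mapsto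 i_j$ and $[e_{k+1},\ldots,e_n](y_{i_{k+1}},\ldots,y_{i_n})$ is the determinant $[e_{k+1},\ldots,e_n]$ formed in the variables $y_{i_{k+1}},\ldots,y_{i_n}$. In particular $[0;e_1,\ldots,e_n]=[e_1,\ldots,e_n]$. A hat means the entry is omitted. Put $L_n=[0,1,\ldots,n-1]$, and for $0\le s_1<\cdots<s_k<n$ define the Mùi invariants $$M_{n,s_1,\ldots,s_k}=[k;0,\ldots,\hat s_1,\ldots,\hat s_k,\ldots,n-1],\qquad M^{(d)}_{n,s_1,\ldots,s_k}=M_{n,s_1,\ldots,s_k}L_n^{d-1}.$$ The list $1,\ldots,\hat s_1,\ldots,\hat s_k,\ldots,n-1,i$ is $1,\ldots,n-1$ in increasing order with $s_1,\ldots,s_k$ omitted, followed by $i$. When $d=1$ the terms with factor $(d-1)L_n^{d-2}$ are $0$. *)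

theory Defs
  imports
    "HOL-Library.Poly_Mapping"
    "HOL-Combinatorics.Permutations"
    "Jordan_Normal_Form.Determinant"
    "Berlekamp_Zassenhaus.Finite_Field"
begin

section \<open>Exterior algebras over a commutative ring\<close>

text \<open>The exterior algebra over a commutative ring on generators indexed by the natural numbers.
  The coefficient of an element at a finite set \<open>{i\<^sub>1 < \<dots> < i\<^sub>k}\<close> is its coefficient at the
  basis element \<open>x\<^bsub>i\<^sub>1\<^esub> \<cdots> x\<^bsub>i\<^sub>k\<^esub>\<close>.\<close>

typedef (overloaded) 'a exterior =
  "{f :: nat set \<Rightarrow> 'a :: comm_ring_1. finite {I. f I \<noteq> 0} \<and> (\<forall>I. f I \<noteq> 0 \<longrightarrow> finite I)}"
  morphisms coef Abs_exterior
  by (rule exI[of _ "\<lambda>_. 0"]) simp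

setup_lifting type_definition_exterior

lemma finite_supp: "finite {I. coef f I \<noteq> 0}"
  using coef[of f] by simp

lemma coef_infinite: "infinite I \<Longrightarrow> coef f I = 0"
  using coef[of f] by auto

lemma exterior_eqI: "(\<And>I. finite I \<Longrightarrow> coef f I = coef g I) \<Longrightarrow> f = g"
  by (metis coef_inject coef_infinite ext)

text \<open>For disjoint \<open>I\<close> and \<open>J\<close> this is the sign \<open>\<epsilon>\<close> with \<open>x\<^sub>I x\<^sub>J = \<epsilon> x\<^bsub>I \<union> J\<^esub>\<close>.\<close>

definition shuffle_sign :: "nat set \<Rightarrow> nat set \<Rightarrow> 'a :: comm_ring_1" where
  "shuffle_sign I J = (- 1) ^ card {(i, j). i \<in> I \<and> j \<in> J \<and> j < i}"

lemma finite_inversions: "finite I \<Longrightarrow> finite J \<Longrightarrow> finite {(i::nat, j::nat). i \<in> I \<and> j \<in> J \<and> j < i}"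
  by (rule finite_subset[of _ "I \<times> J"]) auto

lemma shuffle_sign_empty [simp]: "shuffle_sign {} J = 1" "shuffle_sign I {} = 1"
  by (simp_all add: shuffle_sign_def)

lemma shuffle_sign_Un_left:
  assumes "finite I" "finite J" "finite K" "I \<inter> J = {}"
  shows "shuffle_sign (I \<union> J) K = shuffle_sign I K * shuffle_sign J K"
proof -
  have "{(i, j). i \<in> I \<union> J \<and> j \<in> K \<and> j < i} =
      {(i, j). i \<in> I \<and> j \<in> K \<and> j < i} \<union> {(i, j). i \<in> J \<and> j \<in> K \<and> j < i}" by auto
  moreover have "{(i, j). i \<in> I \<and> j \<in> K \<and> j < i} \<inter> {(i, j). i \<in> J \<and> j \<in> K \<and> j < i} = {}"
    using assms by auto
  ultimately show ?thesis
    using assms by (simp add: shuffle_sign_def card_Un_disjoint finite_inversions power_add)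
qed

lemma shuffle_sign_Un_right:
  assumes "finite I" "finite J" "finite K" "J \<inter> K = {}"
  shows "shuffle_sign I (J \<union> K) = shuffle_sign I J * shuffle_sign I K"
proof -
  have "{(i, j). i \<in> I \<and> j \<in> J \<union> K \<and> j < i} =
      {(i, j). i \<in> I \<and> j \<in> J \<and> j < i} \<union> {(i, j). i \<in> I \<and> j \<in> K \<and> j < i}" by auto
  moreover have "{(i, j). i \<in> I \<and> j \<in> J \<and> j < i} \<inter> {(i, j). i \<in> I \<and> j \<in> K \<and> j < i} = {}"
    using assms by auto
  ultimately show ?thesis
    using assms by (simp add: shuffle_sign_def card_Un_disjoint finite_inversions power_add)
qed

instantiation exterior :: (comm_ring_1) ring_1
begin

lift_definition zero_exterior :: "'a exterior" is "\<lambda>_. 0" by simp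

lift_definition one_exterior :: "'a exterior" is "\<lambda>I. if I = {} then 1 else 0" by simp

lift_definition plus_exterior :: "'a exterior \<Rightarrow> 'a exterior \<Rightarrow> 'a exterior"
  is "\<lambda>f g I. f I + g I"
proof -
  fix f g :: "nat set \<Rightarrow> 'a"
  assume f: "finite {I. f I \<noteq> 0} \<and> (\<forall>I. f I \<noteq> 0 \<longrightarrow> finite I)"
    and g: "finite {I. g I \<noteq> 0} \<and> (\<forall>I. g I \<noteq> 0 \<longrightarrow> finite I)"
  have "finite {I. f I + g I \<noteq> 0}"
    by (rule finite_subset[of _ "{I. f I \<noteq> 0} \<union> {I. g I \<noteq> 0}"]) (use f g in auto)
  moreover have "\<forall>I. f I + g I \<noteq> 0 \<longrightarrow> finite I"
    using f g by (metis add_0)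
  ultimately show "finite {I. f I + g I \<noteq> 0} \<and> (\<forall>I. f I + g I \<noteq> 0 \<longrightarrow> finite I)" by blast
qed

lift_definition uminus_exterior :: "'a exterior \<Rightarrow> 'a exterior" is "\<lambda>f I. - f I" by simp

lift_definition minus_exterior :: "'a exterior \<Rightarrow> 'a exterior \<Rightarrow> 'a exterior"
  is "\<lambda>f g I. f I - g I"
proof -
  fix f g :: "nat set \<Rightarrow> 'a"
  assume f: "finite {I. f I \<noteq> 0} \<and> (\<forall>I. f I \<noteq> 0 \<longrightarrow> finite I)"
    and g: "finite {I. g I \<noteq> 0} \<and> (\<forall>I. g I \<noteq> 0 \<longrightarrow> finite I)"
  have "finite {I. f I - g I \<noteq> 0}"
    by (rule finite_subset[of _ "{I. f I \<noteq> 0} \<union> {I. g I \<noteq> 0}"]) (use f g in auto)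
  moreover have "\<forall>I. f I - g I \<noteq> 0 \<longrightarrow> finite I"
    using f g by (metis diff_0_right)
  ultimately show "finite {I. f I - g I \<noteq> 0} \<and> (\<forall>I. f I - g I \<noteq> 0 \<longrightarrow> finite I)" by blast
qed

lift_definition times_exterior :: "'a exterior \<Rightarrow> 'a exterior \<Rightarrow> 'a exterior"
  is "\<lambda>f g K. \<Sum>I\<in>Pow K. shuffle_sign I (K - I) * f I * g (K - I)"
proof -
  fix f g :: "nat set \<Rightarrow> 'a"
  let ?h = "\<lambda>K. \<Sum>I\<in>Pow K. shuffle_sign I (K - I) * f I * g (K - I)"
  assume f: "finite {I. f I \<noteq> 0} \<and> (\<forall>I. f I \<noteq> 0 \<longrightarrow> finite I)"
    and g: "finite {I. g I \<noteq> 0} \<and> (\<forall>I. g I \<noteq> 0 \<longrightarrow> finite I)"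
  have ex: "\<exists>I. I \<subseteq> K \<and> f I \<noteq> 0 \<and> g (K - I) \<noteq> 0" if "?h K \<noteq> 0" for K
  proof (rule ccontr)
    assume "\<not> ?thesis"
    then have "?h K = 0" by (intro sum.neutral) auto
    with that show False by simp
  qed
  have "{K. ?h K \<noteq> 0} \<subseteq> (\<lambda>(I, J). I \<union> J) ` ({I. f I \<noteq> 0} \<times> {I. g I \<noteq> 0})"
  proof
    fix K assume "K \<in> {K. ?h K \<noteq> 0}"
    then obtain I where "I \<subseteq> K" "f I \<noteq> 0" "g (K - I) \<noteq> 0" using ex by auto
    then show "K \<in> (\<lambda>(I, J). I \<union> J) ` ({I. f I \<noteq> 0} \<times> {I. g I \<noteq> 0})"
      by (intro image_eqI[of _ _ "(I, K - I)"]) auto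
  qed
  then have "finite {K. ?h K \<noteq> 0}" by (rule finite_subset) (use f g in auto)
  moreover have "\<forall>K. ?h K \<noteq> 0 \<longrightarrow> finite K"
    using ex f g by (metis finite_Diff2)
  ultimately show "finite {K. ?h K \<noteq> 0} \<and> (\<forall>K. ?h K \<noteq> 0 \<longrightarrow> finite K)" by blast
qed

instance
proof
  fix f g h :: "'a exterior"
  show "f * g * h = f * (g * h)"
  proof (rule exterior_eqI)
    fix K :: "nat set"
    assume K: "finite K"
    have "coef (f * g * h) K = (\<Sum>I\<in>Pow K. \<Sum>A\<in>Pow I.
        shuffle_sign I (K - I) * (shuffle_sign A (I - A) * coef f A * coef g (I - A)) * coef h (K - I))"
      by (simp add: times_exterior.rep_eq sum_distrib_left sum_distrib_right)
    also have "\<dots> = (\<Sum>(I, A)\<in>(SIGMA I:Pow K. Pow I).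
        shuffle_sign I (K - I) * (shuffle_sign A (I - A) * coef f A * coef g (I - A)) * coef h (K - I))"
      using K by (intro sum.Sigma) (auto intro: finite_subset)
    also have "\<dots> = (\<Sum>(A, B)\<in>(SIGMA A:Pow K. Pow (K - A)).
        shuffle_sign A (K - A) * coef f A * (shuffle_sign B (K - A - B) * coef g B * coef h (K - A - B)))"
    proof (rule sum.reindex_bij_witness[of _ "\<lambda>(A, B). (A \<union> B, A)" "\<lambda>(I, A). (A, I - A)"], goal_cases)
      case (5 a)
      obtain I A where a: "a = (I, A)" by force
      with 5 have IA: "I \<subseteq> K" "A \<subseteq> I" by auto
      define B C where "B = I - A" and "C = K - I"
      have I: "I = A \<union> B" and sets: "K - A = B \<union> C" "K - A - B = C" "I - A = B" "K - I = C"
        using IA by (auto simp: B_def C_def)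
      have fin: "finite A" "finite B" "finite C"
        using IA K by (auto simp: B_def C_def intro: finite_subset)
      have dis: "A \<inter> B = {}" "B \<inter> C = {}"
        using IA by (auto simp: B_def C_def)
      have "shuffle_sign I C = (shuffle_sign A C * shuffle_sign B C :: 'a)"
        unfolding I using fin dis by (intro shuffle_sign_Un_left)
      moreover have "shuffle_sign A (B \<union> C) = (shuffle_sign A B * shuffle_sign A C :: 'a)"
        using fin dis by (intro shuffle_sign_Un_right)
      ultimately show ?case
        unfolding a prod.case sets(3,4) sets(2)[unfolded B_def[symmetric]] sets(1)
        using sets(2) by (simp add: sets(1) mult_ac)
    qed auto
    also have "\<dots> = (\<Sum>A\<in>Pow K. \<Sum>B\<in>Pow (K - A).
        shuffle_sign A (K - A) * coef f A * (shuffle_sign B (K - A - B) * coef g B * coef h (K - A - B)))"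
      using K by (intro sum.Sigma[symmetric]) (auto intro: finite_subset)
    also have "\<dots> = coef (f * (g * h)) K"
      by (simp add: times_exterior.rep_eq sum_distrib_left)
    finally show "coef (f * g * h) K = coef (f * (g * h)) K" .
  qed
  show "1 * f = f"
  proof (rule exterior_eqI)
    fix K :: "nat set" assume "finite K"
    then have "coef (1 * f) K = (\<Sum>I\<in>{{} :: nat set}. coef f K)"
      unfolding times_exterior.rep_eq one_exterior.rep_eq
      by (intro sum.mono_neutral_cong_right) auto
    then show "coef (1 * f) K = coef f K" by simp
  qed
  show "f * 1 = f"
  proof (rule exterior_eqI)
    fix K :: "nat set" assume "finite K"
    then have "coef (f * 1) K = (\<Sum>I\<in>{K}. coef f K)"
      unfolding times_exterior.rep_eq one_exterior.rep_eq
      by (intro sum.mono_neutral_cong_right) auto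
    then show "coef (f * 1) K = coef f K" by simp
  qed
  show "(f + g) * h = f * h + g * h"
    by (rule exterior_eqI) (simp add: times_exterior.rep_eq plus_exterior.rep_eq
        algebra_simps sum.distrib)
  show "f * (g + h) = f * g + f * h"
    by (rule exterior_eqI) (simp add: times_exterior.rep_eq plus_exterior.rep_eq
        algebra_simps sum.distrib)
  show "(0 :: 'a exterior) \<noteq> 1"
    by transfer (auto dest: fun_cong[of _ _ "{}"])
qed (transfer; auto simp: algebra_simps)+

end

lift_definition scal :: "'a :: comm_ring_1 \<Rightarrow> 'a exterior" is "\<lambda>c I. if I = {} then c else 0"
  by simp

lift_definition X :: "nat \<Rightarrow> 'a :: comm_ring_1 exterior" is "\<lambda>j I. if I = {j} then 1 else 0"
  by simp

lemma coef_scal_mult: "coef (scal c * f) I = c * coef f I"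
proof (cases "finite I")
  case True
  have "coef (scal c * f) I = (\<Sum>J\<in>{{} :: nat set}. c * coef f I)"
    unfolding times_exterior.rep_eq scal.rep_eq using True
    by (intro sum.mono_neutral_cong_right) auto
  then show ?thesis by simp
qed (simp add: coef_infinite)

lemma coef_mult_scal: "coef (f * scal c) I = c * coef f I"
proof (cases "finite I")
  case True
  have "coef (f * scal c) I = (\<Sum>J\<in>{I}. c * coef f I)"
    unfolding times_exterior.rep_eq scal.rep_eq using True
    by (intro sum.mono_neutral_cong_right) auto
  then show ?thesis by simp
qed (simp add: coef_infinite)

lemma scal_commute: "scal c * f = f * scal c"
  by (rule exterior_eqI) (simp add: coef_scal_mult coef_mult_scal)

lemma scal_add: "scal (c + d) = scal c + scal d"
  by transfer auto

lemma scal_mult: "scal (c * d) = scal c * scal d"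
  by (rule exterior_eqI) (simp add: coef_scal_mult scal.rep_eq)

lemma scal_1 [simp]: "scal 1 = 1"
  by transfer auto

lemma scal_0 [simp]: "scal 0 = 0"
  by transfer auto

lemma coef_X_mult:
  assumes "finite I"
  shows "coef (X j * f) I = (if j \<in> I then shuffle_sign {j} (I - {j}) * coef f (I - {j}) else 0)"
proof -
  have "coef (X j * f) I = (\<Sum>J\<in>(if j \<in> I then {{j}} else {}).
      shuffle_sign {j} (I - {j}) * coef f (I - {j}))"
    unfolding times_exterior.rep_eq X.rep_eq using assms
    by (intro sum.mono_neutral_cong_right) (auto split: if_splits)
  then show ?thesis by simp
qed

lemma X_square: "X j * X j = (0 :: 'a :: comm_ring_1 exterior)"
proof (rule exterior_eqI)
  fix I :: "nat set" assume "finite I"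
  then show "coef (X j * X j) I = coef (0 :: 'a exterior) I"
    by (auto simp: coef_X_mult zero_exterior.rep_eq X.rep_eq)
qed

lemma X_anticommute: "X i * X j = - (X j * X i :: 'a :: comm_ring_1 exterior)"
proof (cases "i = j")
  case True
  then show ?thesis by (simp add: X_square)
next
  case False
  have sg: "shuffle_sign {a} {b} = (if b < a then - 1 else 1 :: 'a)" for a b :: nat
  proof -
    have "{(i, j). i \<in> {a} \<and> j \<in> {b} \<and> j < i} = (if b < a then {(a, b)} else {})" by auto
    then show ?thesis by (simp add: shuffle_sign_def)
  qed
  show ?thesis
  proof (rule exterior_eqI)
    fix I :: "nat set" assume I: "finite I"
    have "coef (X i * X j) I = (if I = {i, j} then shuffle_sign {i} {j} else 0 :: 'a)"
      using I False by (auto simp: coef_X_mult X.rep_eq)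
    moreover have "coef (X j * X i) I = (if I = {i, j} then shuffle_sign {j} {i} else 0 :: 'a)"
      using I False by (auto simp: coef_X_mult X.rep_eq)
    ultimately show "coef (X i * X j) I = coef (- (X j * X i) :: 'a exterior) I"
      using False by (simp add: uminus_exterior.rep_eq sg)
  qed
qed

lemma coef_prod_X:
  assumes "sorted xs" "distinct xs"
  shows "coef (prod_list (map X xs)) I = (if I = set xs then 1 else 0 :: 'a :: comm_ring_1)"
proof (cases "finite I")
  case True
  then show ?thesis using assms
  proof (induction xs arbitrary: I)
    case Nil
    then show ?case by (simp add: one_exterior.rep_eq)
  next
    case (Cons a xs)
    have eq: "a \<in> I \<and> I - {a} = set xs \<longleftrightarrow> I = set (a # xs)"
      using Cons.prems by auto
    have none: "{(i, j). i \<in> {a} \<and> j \<in> set xs \<and> j < i} = {}"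
      using Cons.prems by (auto simp: not_less[symmetric])
    have "shuffle_sign {a} (set xs) = (1 :: 'a)"
      unfolding shuffle_sign_def none by simp
    then show ?case
      using Cons eq by (auto simp: coef_X_mult)
  qed
qed (auto simp: coef_infinite)

section \<open>The algebras \<open>P\<^sub>n\<close>\<close>

text \<open>With \<open>p = CARD('p)\<close>, the type \<^typ>\<open>'p mod_ring\<close> is the field with \<open>p\<close> elements and \<open>poly_y\<close>
  is the polynomial ring over it in variables indexed by the natural numbers. The type \<open>cohom\<close>
  is the exterior algebra over the latter, that is \<open>E(x\<^sub>0, x\<^sub>1, \<dots>) \<otimes> F\<^sub>p[y\<^sub>0, y\<^sub>1, \<dots>]\<close>. It contains
  \<open>P\<^sub>n\<close> as the subalgebra on the generators with indices \<open>1, \<dots>, n\<close>.\<close>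

type_synonym 'p poly_y =
  "(nat \<Rightarrow>\<^sub>0 nat) \<Rightarrow>\<^sub>0 'p mod_ring"

type_synonym 'p cohom = "'p poly_y exterior"

definition yvar :: "nat \<Rightarrow> 'p :: prime_card poly_y" where
  "yvar j = Poly_Mapping.single (Poly_Mapping.single j 1) 1"

definition Y :: "nat \<Rightarrow> 'p :: prime_card cohom" where
  "Y j = scal (yvar j)"

definition Fp :: "'p :: prime_card mod_ring \<Rightarrow> 'p cohom" where
  "Fp c = scal (Poly_Mapping.single 0 c)"

inductive_set subalg :: "nat set \<Rightarrow> 'p :: prime_card cohom set" for A :: "nat set" where
  scalar: "Fp c \<in> subalg A"
| gen_x: "j \<in> A \<Longrightarrow> X j \<in> subalg A"
| gen_y: "j \<in> A \<Longrightarrow> Y j \<in> subalg A"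
| sum: "f \<in> subalg A \<Longrightarrow> g \<in> subalg A \<Longrightarrow> f + g \<in> subalg A"
| prod: "f \<in> subalg A \<Longrightarrow> g \<in> subalg A \<Longrightarrow> f * g \<in> subalg A"

definition P :: "nat \<Rightarrow> 'p :: prime_card cohom set" where
  "P n = subalg {1..n}"

section \<open>The primitive operations\<close>

definition is_St :: "nat \<Rightarrow> ('p :: prime_card cohom \<Rightarrow> 'p cohom) \<Rightarrow> bool" where
  "is_St i D \<longleftrightarrow>
     (\<forall>f g. D (f + g) = D f + D g) \<and>
     (\<forall>c f. D (Fp c * f) = Fp c * D f) \<and>
     (\<forall>f g. D (f * g) = D f * g + f * D g) \<and>
     (\<forall>j. D (X j) = 0) \<and>
     (\<forall>j. D (Y j) = Y j ^ (CARD('p) ^ i))"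

text \<open>Existence and uniqueness are \<open>ex1_is_St\<close> below. The operation has even degree
  \<open>2 (p\<^sup>i - 1)\<close>, so there are no signs in the Leibniz rule.\<close>

definition St :: "nat \<Rightarrow> 'p :: prime_card cohom \<Rightarrow> 'p cohom" where
  "St i = (THE D. is_St i D)"

text \<open>The derivation on the polynomial part sends a monomial \<open>m\<close> with exponents \<open>\<alpha>\<close> to
  \<open>m \<cdot> (\<Sum>j. \<alpha>\<^sub>j y\<^sub>j\<^sup>q\<^sup>-\<^sup>1)\<close> with \<open>q = p\<^sup>i\<close>, and \<open>St\<close> acts on coefficients by it.\<close>

context
begin

private definition weight :: "nat \<Rightarrow> (nat \<Rightarrow>\<^sub>0 nat) \<Rightarrow> 'p :: prime_card poly_y" where
  "weight q \<alpha> = (\<Sum>j\<in>Poly_Mapping.keys \<alpha>. of_nat (Poly_Mapping.lookup \<alpha> j) * yvar j ^ (q - 1))"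

private lemma weight_superset:
  assumes "finite S" "Poly_Mapping.keys \<alpha> \<subseteq> S"
  shows "weight q \<alpha> = (\<Sum>j\<in>S. of_nat (Poly_Mapping.lookup \<alpha> j) * yvar j ^ (q - 1))"
  unfolding weight_def using assms
  by (intro sum.mono_neutral_left) (auto simp: in_keys_iff)

private lemma weight_add: "weight q (\<alpha> + \<beta>) = weight q \<alpha> + weight q \<beta>"
proof -
  let ?S = "Poly_Mapping.keys \<alpha> \<union> Poly_Mapping.keys \<beta>"
  have "Poly_Mapping.keys (\<alpha> + \<beta>) \<subseteq> ?S" by (rule Poly_Mapping.keys_add)
  then show ?thesis
    by (simp add: weight_superset[of ?S] lookup_add algebra_simps sum.distrib)
qed

private definition dpoly :: "nat \<Rightarrow> 'p :: prime_card poly_y \<Rightarrow> 'p poly_y" where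
  "dpoly q f = (\<Sum>\<alpha>\<in>Poly_Mapping.keys f.
     Poly_Mapping.single \<alpha> (Poly_Mapping.lookup f \<alpha>) * weight q \<alpha>)"

private lemma dpoly_superset:
  assumes "finite S" "Poly_Mapping.keys f \<subseteq> S"
  shows "dpoly q f = (\<Sum>\<alpha>\<in>S. Poly_Mapping.single \<alpha> (Poly_Mapping.lookup f \<alpha>) * weight q \<alpha>)"
  unfolding dpoly_def using assms
  by (intro sum.mono_neutral_left) (auto simp: in_keys_iff)

private lemma dpoly_add: "dpoly q (f + g) = dpoly q f + dpoly q g"
proof -
  let ?S = "Poly_Mapping.keys f \<union> Poly_Mapping.keys g"
  have "Poly_Mapping.keys (f + g) \<subseteq> ?S" by (rule Poly_Mapping.keys_add)
  then show ?thesis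
    by (simp add: dpoly_superset[of ?S] lookup_add single_add algebra_simps sum.distrib)
qed

private lemma dpoly_single:
  "dpoly q (Poly_Mapping.single \<alpha> c) = Poly_Mapping.single \<alpha> c * weight q \<alpha>"
  by (subst dpoly_superset[of "{\<alpha>}"]) auto

private lemma dpoly_0 [simp]: "dpoly q 0 = 0"
  by (simp add: dpoly_def)

private lemma dpoly_sum: "dpoly q (sum f A) = (\<Sum>a\<in>A. dpoly q (f a))"
  by (induction A rule: infinite_finite_induct) (simp_all add: dpoly_add)

lemma sum_singles:
  "(\<Sum>\<alpha>\<in>Poly_Mapping.keys f. Poly_Mapping.single \<alpha> (Poly_Mapping.lookup f \<alpha>)) = f"
  by (rule poly_mapping_eqI) (simp add: lookup_sum lookup_single when_def in_keys_iff)

private lemma dpoly_mult: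
  "dpoly q (f * g) = dpoly q f * g + f * dpoly q (g :: 'p :: prime_card poly_y)"
proof -
  let ?m = "\<lambda>f \<alpha>. Poly_Mapping.single \<alpha> (Poly_Mapping.lookup f \<alpha>) :: 'p poly_y"
  have 1: "dpoly q (?m f \<alpha> * ?m g \<beta>) = dpoly q (?m f \<alpha>) * ?m g \<beta> + ?m f \<alpha> * dpoly q (?m g \<beta>)"
    for \<alpha> \<beta>
    unfolding mult_single dpoly_single weight_add
    unfolding mult_single[symmetric] by (simp add: algebra_simps)
  have "f * g = (\<Sum>\<alpha>\<in>Poly_Mapping.keys f. \<Sum>\<beta>\<in>Poly_Mapping.keys g. ?m f \<alpha> * ?m g \<beta>)"
    unfolding sum_product[symmetric] sum_singles ..
  then have "dpoly q (f * g) = (\<Sum>\<alpha>\<in>Poly_Mapping.keys f. \<Sum>\<beta>\<in>Poly_Mapping.keys g.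
      dpoly q (?m f \<alpha>) * ?m g \<beta> + ?m f \<alpha> * dpoly q (?m g \<beta>))"
    by (simp only: dpoly_sum 1)
  also have "\<dots> = (\<Sum>\<alpha>\<in>Poly_Mapping.keys f. dpoly q (?m f \<alpha>)) * (\<Sum>\<beta>\<in>Poly_Mapping.keys g. ?m g \<beta>)
      + (\<Sum>\<alpha>\<in>Poly_Mapping.keys f. ?m f \<alpha>) * (\<Sum>\<beta>\<in>Poly_Mapping.keys g. dpoly q (?m g \<beta>))"
    by (simp add: sum_product sum.distrib)
  also have "\<dots> = dpoly q f * g + f * dpoly q g"
    unfolding dpoly_sum[symmetric] sum_singles ..
  finally show ?thesis .
qed

private lift_definition dext :: "nat \<Rightarrow> 'p :: prime_card cohom \<Rightarrow> 'p cohom"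
  is "\<lambda>q f I. dpoly q (f I)"
proof -
  fix q and f :: "nat set \<Rightarrow> 'p poly_y"
  assume f: "finite {I. f I \<noteq> 0} \<and> (\<forall>I. f I \<noteq> 0 \<longrightarrow> finite I)"
  have nz: "f I \<noteq> 0" if "dpoly q (f I) \<noteq> 0" for I using that by auto
  show "finite {I. dpoly q (f I) \<noteq> 0} \<and> (\<forall>I. dpoly q (f I) \<noteq> 0 \<longrightarrow> finite I)"
    using f nz by (auto intro: finite_subset[of _ "{I. f I \<noteq> 0}"])
qed

private lemma dpoly_const [simp]: "dpoly q (Poly_Mapping.single 0 c) = 0"
  by (simp add: dpoly_single weight_def)

private lemma dpoly_1 [simp]: "dpoly q 1 = 0"
  using dpoly_const[of q 1] by simp

private lemma dpoly_power_neg_1: "dpoly q ((- 1) ^ k) = (0 :: 'a :: prime_card poly_y)"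
proof -
  have "dpoly q (- 1 :: 'a poly_y) + dpoly q 1 = 0"
    unfolding dpoly_add[symmetric] by simp
  then have "dpoly q (- 1 :: 'a poly_y) = 0" by simp
  then show ?thesis
    by (induction k) (simp_all add: dpoly_mult del: mult_minus_left mult_minus1)
qed

private lemma dext_is_St: "is_St i (dext (CARD('p) ^ i) :: 'p :: prime_card cohom \<Rightarrow> 'p cohom)"
proof -
  let ?q = "CARD('p) ^ i"
  let ?D = "dext ?q :: 'p cohom \<Rightarrow> 'p cohom"
  have q: "Suc (?q - 1) = ?q" by simp
  have add: "?D (f + g) = ?D f + ?D g" for f g
    by transfer (simp add: dpoly_add)
  have mult: "?D (f * g) = ?D f * g + f * ?D g" for f g
    by (rule exterior_eqI)
      (simp add: dext.rep_eq times_exterior.rep_eq plus_exterior.rep_eq dpoly_sum dpoly_mult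
        shuffle_sign_def dpoly_power_neg_1 algebra_simps sum.distrib)
  have const: "?D (Fp c) = 0" for c
    unfolding Fp_def by transfer auto
  have "?D (X j) = 0" for j
    by transfer auto
  moreover have "?D (Y j) = Y j ^ ?q" for j
  proof -
    have "dpoly ?q (yvar j :: 'p poly_y) = yvar j * yvar j ^ (?q - 1)"
      by (simp add: yvar_def dpoly_single weight_def)
    then have "dpoly ?q (yvar j :: 'p poly_y) = yvar j ^ ?q"
      by (metis power_Suc q)
    moreover have "scal (c ^ k) = scal c ^ k" for c :: "'p poly_y" and k
      by (induction k) (simp_all add: scal_mult)
    moreover have "?D (scal c) = scal (dpoly ?q c)" for c
      by transfer auto
    ultimately show ?thesis by (simp add: Y_def)
  qed
  ultimately show ?thesis
    unfolding is_St_def using add mult const by simp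
qed

lemma zero_in_subalg: "0 \<in> subalg A"
  using subalg.scalar[of 0 A] by (simp add: Fp_def)

lemma one_in_subalg: "1 \<in> subalg A"
  using subalg.scalar[of 1 A] by (simp add: Fp_def)

lemma sum_in_subalg: "(\<And>a. a \<in> S \<Longrightarrow> f a \<in> subalg A) \<Longrightarrow> sum f S \<in> subalg A"
  by (induction S rule: infinite_finite_induct) (auto intro: zero_in_subalg subalg.sum)

lemma power_in_subalg: "f \<in> subalg A \<Longrightarrow> f ^ k \<in> subalg A"
  by (induction k) (auto intro: one_in_subalg subalg.prod)

lemma prod_list_in_subalg: "set fs \<subseteq> subalg A \<Longrightarrow> prod_list fs \<in> subalg A"
  by (induction fs) (auto intro: one_in_subalg subalg.prod)

lemma uminus_in_subalg: "f \<in> subalg A \<Longrightarrow> - f \<in> subalg A"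
proof -
  have "Fp (- 1) * f = - f"
    by (rule exterior_eqI)
      (simp add: Fp_def coef_scal_mult uminus_exterior.rep_eq single_uminus)
  then show "f \<in> subalg A \<Longrightarrow> - f \<in> subalg A"
    by (metis subalg.prod subalg.scalar)
qed

lemma of_int_in_subalg: "of_int c \<in> subalg A"
proof -
  have "of_nat k \<in> subalg A" for k
    by (induction k) (auto intro: zero_in_subalg one_in_subalg subalg.sum)
  then show ?thesis
    by (cases c) (auto simp only: of_int_of_nat_eq of_int_minus intro: uminus_in_subalg)
qed

lemma scal_sum: "scal (sum f S) = (\<Sum>a\<in>S. scal (f a))"
  by (induction S rule: infinite_finite_induct) (simp_all add: scal_add)

lemma scal_power: "scal (c ^ k) = scal c ^ k"
  by (induction k) (simp_all add: scal_mult)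

lemma scal_prod_in_subalg:
  "(\<And>a. a \<in> S \<Longrightarrow> scal (f a) \<in> subalg A) \<Longrightarrow> scal (prod f S) \<in> subalg A"
  by (induction S rule: infinite_finite_induct)
    (auto intro: one_in_subalg subalg.prod simp: scal_mult)

lemma scal_in_subalg_UNIV: "scal f \<in> subalg UNIV"
proof -
  have pow: "yvar j ^ k = (Poly_Mapping.single (Poly_Mapping.single j k) 1 :: 'a poly_y)" for j k
    by (induction k) (simp_all add: yvar_def mult_single flip: single_add)
  have mono: "Poly_Mapping.single \<alpha> (1 :: 'a mod_ring) =
      (\<Prod>j\<in>Poly_Mapping.keys \<alpha>. yvar j ^ Poly_Mapping.lookup \<alpha> j)" for \<alpha>
  proof -
    have "(\<Prod>j\<in>S. Poly_Mapping.single (Poly_Mapping.single j (e j)) 1) =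
        Poly_Mapping.single (\<Sum>j\<in>S. Poly_Mapping.single j (e j)) (1 :: 'a mod_ring)"
      if "finite S" for S and e :: "nat \<Rightarrow> nat"
      using that by (induction S) (simp_all add: mult_single)
    from this[of "Poly_Mapping.keys \<alpha>" "Poly_Mapping.lookup \<alpha>"] show ?thesis
      by (simp add: pow sum_singles)
  qed
  have "scal (Poly_Mapping.single \<alpha> c) \<in> subalg UNIV" for \<alpha> and c :: "'a mod_ring"
  proof -
    have "scal (Poly_Mapping.single \<alpha> c) = Fp c * scal (Poly_Mapping.single \<alpha> 1)"
      by (simp add: Fp_def mult_single flip: scal_mult)
    moreover have "scal (Poly_Mapping.single \<alpha> (1 :: 'a mod_ring)) \<in> subalg UNIV"
      unfolding mono
      by (intro scal_prod_in_subalg)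
        (simp add: scal_power power_in_subalg subalg.gen_y flip: Y_def)
    ultimately show ?thesis by (simp add: subalg.prod subalg.scalar)
  qed
  then show ?thesis
    by (subst sum_singles[symmetric]) (simp only: scal_sum, intro sum_in_subalg)
qed

lemma subalg_UNIV: "subalg UNIV = UNIV"
proof -
  have "f \<in> subalg UNIV" for f :: "'a cohom"
  proof -
    let ?S = "{I. coef f I \<noteq> 0}"
    have csum: "coef (sum g S) I = (\<Sum>a\<in>S. coef (g a) I)" for g :: "nat set \<Rightarrow> 'a cohom" and S I
      by (induction S rule: infinite_finite_induct) (simp_all add: zero_exterior.rep_eq plus_exterior.rep_eq)
    have fin: "finite I" if "coef f I \<noteq> 0" for I
      using that coef_infinite by blast
    have "f = (\<Sum>I\<in>?S. scal (coef f I) * prod_list (map X (sorted_list_of_set I)))"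
    proof (rule exterior_eqI)
      fix K :: "nat set"
      have "coef (\<Sum>I\<in>?S. scal (coef f I) * prod_list (map X (sorted_list_of_set I))) K =
          (\<Sum>I\<in>?S. if K = I then coef f I else 0)"
        unfolding csum using fin by (intro sum.cong) (auto simp: coef_scal_mult coef_prod_X)
      also have "\<dots> = coef f K"
        using finite_supp[of f] by auto
      finally show "coef f K =
        coef (\<Sum>I\<in>?S. scal (coef f I) * prod_list (map X (sorted_list_of_set I))) K" ..
    qed
    also have "\<dots> \<in> subalg UNIV"
      by (intro sum_in_subalg subalg.prod scal_in_subalg_UNIV prod_list_in_subalg)
        (auto intro: subalg.gen_x)
    finally show ?thesis .
  qed
  then show ?thesis by blast
qed

lemma derivation_unique:
  assumes D: "is_St i D"
    and add: "\<And>f g. f \<in> subalg A \<Longrightarrow> g \<in> subalg A \<Longrightarrow> D' (f + g) = D' f + D' g"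
    and lin: "\<And>c f. f \<in> subalg A \<Longrightarrow> D' (Fp c * f) = Fp c * D' f"
    and mult: "\<And>f g. f \<in> subalg A \<Longrightarrow> g \<in> subalg A \<Longrightarrow> D' (f * g) = D' f * g + f * D' g"
    and X: "\<And>j. j \<in> A \<Longrightarrow> D' (X j) = 0"
    and Y: "\<And>j. j \<in> A \<Longrightarrow> D' (Y j) = Y j ^ (CARD('p) ^ i)"
    and f: "f \<in> subalg A"
  shows "D' f = (D f :: 'p :: prime_card cohom)"
  using f
proof induction
  case (scalar c)
  have "D' 1 = 0" using mult[OF one_in_subalg one_in_subalg] by simp
  then have "D' (Fp c) = 0" using lin[OF one_in_subalg, of c] by simp
  moreover have "D 1 = D 1 + D 1" using D unfolding is_St_def by (metis mult_1 mult_1_right)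
  then have "D 1 = 0" by simp
  then have "D (Fp c) = 0" using D unfolding is_St_def by (metis mult_1_right mult_zero_right)
  ultimately show ?case by simp
qed (use D in \<open>simp_all add: is_St_def add mult X Y\<close>)

theorem ex1_is_St: "\<exists>!D. is_St i (D :: 'p :: prime_card cohom \<Rightarrow> 'p cohom)"
proof (rule ex_ex1I)
  show "\<exists>D. is_St i (D :: 'p cohom \<Rightarrow> 'p cohom)" using dext_is_St by blast
next
  fix D D' :: "'p cohom \<Rightarrow> 'p cohom"
  assume D: "is_St i D" and D': "is_St i D'"
  show "D = D'"
  proof
    fix f
    show "D f = D' f"
      using D by (intro derivation_unique[OF D', of UNIV])
        (auto simp: is_St_def subalg_UNIV)
  qed
qed

lemma is_St_St: "is_St i (St i)"
  unfolding St_def by (rule theI'[OF ex1_is_St])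

lemma St_in_subalg: "(f :: 'a :: prime_card cohom) \<in> subalg A \<Longrightarrow> St i f \<in> subalg A"
proof (induction rule: subalg.induct)
  case (scalar c)
  have "St i 1 = St i 1 + (St i 1 :: 'a cohom)"
    using is_St_St[of i] unfolding is_St_def by (metis mult_1 mult_1_right)
  then have "St i (1 :: 'a cohom) = 0" by simp
  then have "St i (Fp c) = 0"
    using is_St_St[of i] unfolding is_St_def by (metis mult_1_right mult_zero_right)
  then show ?case by (simp add: zero_in_subalg)
qed (use is_St_St[where 'a = 'a and i = i, unfolded is_St_def] in
  \<open>auto intro: zero_in_subalg power_in_subalg subalg.intros\<close>)

text \<open>Hence \<open>St i\<close> restricts to \<open>P n\<close>, and the restriction is the only derivation of \<open>P n\<close> with
  the prescribed values on the generators.\<close>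

lemma St_in_P: "f \<in> P n \<Longrightarrow> St i f \<in> P n"
  unfolding P_def by (rule St_in_subalg)

lemmas St_unique_on_P = derivation_unique[OF is_St_St, of "{1..n}" for n, folded P_def]

end

section \<open>Determinants and the Mui invariants\<close>

text \<open>\<open>ybracket vs [e\<^sub>1, \<dots>, e\<^sub>m]\<close> is the determinant \<open>[e\<^sub>1, \<dots>, e\<^sub>m]\<close> formed in the variables whose
  indices are listed in \<open>vs\<close>; list positions start at 0.\<close>

definition ybracket :: "nat list \<Rightarrow> nat list \<Rightarrow> 'p :: prime_card poly_y" where
  "ybracket vs es =
     det (mat (length es) (length es) (\<lambda>(a, b). yvar (vs ! a) ^ (CARD('p) ^ (es ! b))))"

definition bracket :: "nat list \<Rightarrow> 'p :: prime_card cohom" where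
  "bracket es = scal (ybracket [1..<length es + 1] es)"

text \<open>For \<open>I = {i\<^sub>1 < \<dots> < i\<^sub>k} \<subseteq> {1, \<dots>, n}\<close> with complement \<open>{i\<^bsub>k+1\<^esub> < \<dots> < i\<^sub>n}\<close>, the permutation
  \<open>j \<mapsto> i\<^sub>j\<close> of \<open>{1, \<dots>, n}\<close>.\<close>

definition laplace_perm :: "nat \<Rightarrow> nat set \<Rightarrow> nat \<Rightarrow> nat" where
  "laplace_perm n I j =
     (if j \<in> {1..n} then (sorted_list_of_set I @ sorted_list_of_set ({1..n} - I)) ! (j - 1) else j)"

text \<open>\<open>mixed_bracket k [e\<^bsub>k+1\<^esub>, \<dots>, e\<^sub>n]\<close> is \<open>[k; e\<^bsub>k+1\<^esub>, \<dots>, e\<^sub>n]\<close>; thus \<open>n\<close> is \<open>k\<close> plus the length of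
  the list.\<close>

definition mixed_bracket :: "nat \<Rightarrow> nat list \<Rightarrow> 'p :: prime_card cohom" where
  "mixed_bracket k es = (let n = k + length es in
     \<Sum>I | I \<subseteq> {1..n} \<and> card I = k.
       of_int (sign (laplace_perm n I)) * prod_list (map X (sorted_list_of_set I)) *
       scal (ybracket (sorted_list_of_set ({1..n} - I)) es))"

definition L :: "nat \<Rightarrow> 'p :: prime_card cohom" where
  "L n = bracket [0..<n]"

definition Mui :: "nat \<Rightarrow> nat list \<Rightarrow> 'p :: prime_card cohom" where
  "Mui n ss = mixed_bracket (length ss) (filter (\<lambda>e. e \<notin> set ss) [0..<n])"

text \<open>\<open>M\<^sup>(\<^sup>d\<^sup>)\<close>, for \<open>d \<ge> 1\<close>\<close>

definition Mui_pow :: "nat \<Rightarrow> nat \<Rightarrow> nat list \<Rightarrow> 'p :: prime_card cohom" where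
  "Mui_pow d n ss = Mui n ss * L n ^ (d - 1)"

lemma ybracket_in_subalg:
  assumes "length vs = length es" "set vs \<subseteq> A"
  shows "scal (ybracket vs es :: 'p :: prime_card poly_y) \<in> subalg A"
proof -
  let ?m = "length es"
  have "scal (yvar (vs ! a) ^ k :: 'p poly_y) \<in> subalg A" if "a < ?m" for a k
    using that assms by (auto simp: scal_power simp flip: Y_def intro!: power_in_subalg subalg.gen_y)
  then have "scal (\<Prod>a = 0..<?m. yvar (vs ! a) ^ (CARD('p) ^ (es ! \<pi> a)) :: 'p poly_y) \<in> subalg A"
    for \<pi> by (intro scal_prod_in_subalg) auto
  moreover have "scal (- c) = - scal c" for c :: "'p poly_y"
    by transfer auto
  ultimately have "scal (signof \<pi> * (\<Prod>a = 0..<?m. yvar (vs ! a) ^ (CARD('p) ^ (es ! \<pi> a)) :: 'p poly_y))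
      \<in> subalg A" for \<pi>
    by (simp add: sign_def uminus_in_subalg)
  moreover have "ybracket vs es = (\<Sum>\<pi> | \<pi> permutes {0..<?m}.
      signof \<pi> * (\<Prod>a = 0..<?m. yvar (vs ! a) ^ (CARD('p) ^ (es ! \<pi> a)) :: 'p poly_y))"
    unfolding ybracket_def det_def
    by (auto intro!: sum.cong prod.cong arg_cong2[of _ _ _ _ "(*)"])
  ultimately show ?thesis
    by (simp add: scal_sum sum_in_subalg)
qed

lemma mixed_bracket_in_P: "mixed_bracket k es \<in> P (k + length es)"
proof -
  let ?n = "k + length es"
  have "of_int (sign (laplace_perm ?n I)) * prod_list (map X (sorted_list_of_set I)) *
      scal (ybracket (sorted_list_of_set ({1..?n} - I)) es) \<in> subalg {1..?n}"
    if "I \<subseteq> {1..?n} \<and> card I = k" for I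
  proof -
    have "finite I" using that by (auto intro: finite_subset)
    with that show ?thesis
      by (intro subalg.prod of_int_in_subalg prod_list_in_subalg ybracket_in_subalg)
        (auto simp: card_Diff_subset intro: subalg.gen_x)
  qed
  then show ?thesis
    by (auto simp: mixed_bracket_def P_def Let_def intro!: sum_in_subalg)
qed

lemma mixed_bracket_0: "mixed_bracket 0 es = bracket es"
proof -
  have "{I. I \<subseteq> {1..length es} \<and> card I = 0} = {{}}"
    by (auto dest: finite_subset)
  moreover have "laplace_perm (length es) {} = id"
    by (auto simp: laplace_perm_def fun_eq_iff simp del: upt_Suc
        simp flip: atLeastLessThanSuc_atLeastAtMost)
  ultimately show ?thesis
    by (simp add: mixed_bracket_def bracket_def sign_id Let_def flip: atLeastLessThanSuc_atLeastAtMost)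
qed

lemma Mui_pow_in_P:
  assumes "distinct ss" "set ss \<subseteq> {0..<n}"
  shows "Mui_pow d n ss \<in> P n"
proof -
  have "length (filter (\<lambda>e. e \<notin> set ss) [0..<n]) = card ({0..<n} - set ss)"
    by (subst distinct_card[symmetric]) (auto intro!: arg_cong[of _ _ card])
  then have "length ss + length (filter (\<lambda>e. e \<notin> set ss) [0..<n]) = n"
    using assms card_mono[OF _ assms(2)] by (simp add: card_Diff_subset distinct_card)
  then have "Mui n ss \<in> P n"
    using mixed_bracket_in_P unfolding Mui_def by metis
  moreover have "L n \<in> P n"
    using mixed_bracket_in_P[of 0 "[0..<n]"] by (simp add: L_def mixed_bracket_0)
  ultimately show ?thesis
    unfolding Mui_pow_def P_def by (intro subalg.prod power_in_subalg)
qed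

end

theory Submission
  imports Defs
begin

text \<open>
  The operation \<open>St i\<close> is a derivation that kills every \<open>x\<close> and, in characteristic \<open>p\<close>, every
  \<open>p\<close>-th power. So in a determinant \<open>[k; e\<^sub>k\<^sub>+\<^sub>1, \<dots>, e\<^sub>n]\<close> it can only act on a row with exponent
  \<open>e = 0\<close>, which it turns into the row with exponent \<open>i\<close>. If no exponent is zero, the result is zero
  (\<open>St_mixed_bracket_eq_0\<close>); if exactly one is zero, that entry of the list is replaced by \<open>i\<close>
  (\<open>St_mixed_bracket_Cons\<close>).

  The exponent list of a Mui invariant is \<open>0, \<dots>, n - 1\<close> without the \<open>s\<^sub>j\<close>. If \<open>s\<^sub>1 = 0\<close>, the exponent
  \<open>0\<close> is missing and the invariant is killed. Otherwise \<open>0\<close> becomes \<open>i\<close> in the first position, and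
  the alternation of determinants in the exponents decides the outcome: the result vanishes if
  \<open>i < n\<close> already occurs (\<open>St_Mui_repeated\<close>); if \<open>i = s\<^sub>t\<close>, moving \<open>i\<close> to its place in increasing order
  gives the Mui invariant in which \<open>0\<close> is omitted instead of \<open>s\<^sub>t\<close> (\<open>St_Mui_exchange\<close>); if
  \<open>i \<ge> n\<close>, its place is the last one (\<open>St_Mui_large\<close>). The signs count the exponents passed over,
  which are \<open>s\<^sub>t - t\<close> and \<open>n - 1 - k\<close> many.

  Since \<open>L n\<close> is the Mui invariant with nothing omitted, the same rules compute its image, and the
  Leibniz rule combines the two (\<open>St_Mui_pow\<close>).
\<close>

section \<open>Derivation rules for the primitive operations\<close>

lemma St_add: "St i (f + g) = St i f + St i g"
  using is_St_St unfolding is_St_def by blast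

lemma St_mult: "St i (f * g) = St i f * g + f * St i g"
  using is_St_St unfolding is_St_def by blast

lemma St_X: "St i (X j) = 0"
  using is_St_St unfolding is_St_def by blast

lemma St_Y: "St i (Y j :: 'p :: prime_card cohom) = Y j ^ (CARD('p) ^ i)"
  using is_St_St unfolding is_St_def by blast

lemma St_0: "St i 0 = 0"
  using St_add[of i 0 0] by simp

lemma St_1: "St i 1 = 0"
  using St_mult[of i 1 1] by simp

lemma St_uminus: "St i (- f) = - St i f"
  using St_add[of i f "- f"] by (simp add: St_0 eq_neg_iff_add_eq_0 add.commute)

lemma St_sum: "St i (sum f S) = (\<Sum>a\<in>S. St i (f a))"
  by (induction S rule: infinite_finite_induct) (simp_all add: St_0 St_add)

lemma St_of_nat: "St i (of_nat m) = 0"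
  by (induction m) (simp_all add: St_0 St_1 St_add)

lemma St_of_int: "St i (of_int c) = 0"
  by (cases c) (simp_all only: of_int_of_nat_eq of_int_minus St_uminus St_of_nat minus_zero)

lemma St_of_int_mult: "St i (of_int c * f) = of_int c * St i f"
  by (simp add: St_mult St_of_int)

text \<open>The usual rule for powers needs the base to commute with its derivative; scalars are
  central.\<close>

lemma St_power_scal: "St i (scal c ^ m) = of_nat m * St i (scal c) * scal c ^ (m - 1)"
proof (induction m)
  case (Suc m)
  have "scal c * (of_nat m * St i (scal c) * scal c ^ (m - 1)) =
      of_nat m * St i (scal c) * scal c ^ (m - 1) * scal c"
    by (rule scal_commute)
  also have "\<dots> = of_nat m * St i (scal c) * scal c ^ m"
    by (cases m) (simp_all only: of_nat_0 mult_zero_left diff_Suc_1 power_Suc2 mult.assoc)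
  finally show ?case
    using Suc by (simp add: St_mult distrib_right)
qed (simp add: St_1)

lemma St_prod_list_X: "St i (prod_list (map X js)) = 0"
  by (induction js) (simp_all add: St_1 St_mult St_X)

section \<open>The operation on determinants\<close>

lemma scal_of_int: "scal (of_int c) = of_int c"
proof -
  have minus: "scal (- a) = - scal a" for a :: 'a
    by transfer auto
  have "scal (of_nat m :: 'a) = of_nat m" for m
    by (induction m) (simp_all add: scal_add)
  then show ?thesis
    by (cases c) (simp_all only: of_int_of_nat_eq of_int_minus minus)
qed

text \<open>Here the characteristic enters: the derivative of a power with exponent \<open>p\<^sup>e\<close> has the factor
  \<open>p\<^sup>e\<close>, which is zero for \<open>e > 0\<close>.\<close>

lemma St_scal_yvar_frobenius:
  assumes "e > 0"
  shows "St i (scal (yvar j ^ (CARD('p :: prime_card) ^ e) :: 'p poly_y)) = 0"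
proof -
  have Fp_of_nat: "of_nat m = (Fp (of_nat m) :: 'p cohom)" for m
  proof (induction m)
    case (Suc m)
    have "Fp (1 + of_nat m) = (Fp 1 + Fp (of_nat m) :: 'p cohom)"
      by (simp add: Fp_def single_add scal_add)
    with Suc show ?case by (simp add: Fp_def)
  qed (simp add: Fp_def)
  have "of_nat (CARD('p) ^ e) = (0 :: 'p mod_ring)"
    using assms by (simp add: of_nat_card_eq_0)
  then have "of_nat (CARD('p) ^ e) = (0 :: 'p cohom)"
    unfolding Fp_of_nat by (simp only: Fp_def single_zero scal_0)
  then show ?thesis
    by (simp only: scal_power St_power_scal mult_zero_left)
qed

lemma St_scal_det_eq_0:
  assumes A: "A \<in> carrier_mat m m"
    and entries: "\<And>a b. a < m \<Longrightarrow> b < m \<Longrightarrow> St i (scal (A $$ (a, b))) = 0"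
  shows "St i (scal (det A)) = 0"
proof -
  have prod: "St i (scal (prod f S)) = 0" if "\<And>a. a \<in> S \<Longrightarrow> St i (scal (f a)) = 0"
      for f :: "nat \<Rightarrow> 'a poly_y" and S
    using that by (induction S rule: infinite_finite_induct) (simp_all add: St_1 scal_mult St_mult)
  have "St i (scal (\<Prod>a = 0..<m. A $$ (a, \<pi> a))) = 0" if "\<pi> permutes {0..<m}" for \<pi>
    using permutes_in_image[OF that] by (intro prod entries) auto
  then show ?thesis
    unfolding det_def'[OF A] scal_sum St_sum
    by (intro sum.neutral) (auto simp: scal_mult scal_of_int St_of_int_mult)
qed

lemma St_scal_ybracket_eq_0:
  assumes "0 \<notin> set es"
  shows "St i (scal (ybracket vs es)) = 0"
  unfolding ybracket_def
proof (rule St_scal_det_eq_0)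
  fix a b assume "a < length es" "b < length es"
  moreover from this have "es ! b > 0"
    using assms nth_mem by (metis gr0I)
  ultimately show "St i (scal (mat (length es) (length es)
      (\<lambda>(a, b). yvar (vs ! a) ^ CARD('a) ^ es ! b) $$ (a, b) :: 'a poly_y)) = 0"
    by (simp add: St_scal_yvar_frobenius)
qed simp

text \<open>Expand along the column of exponent \<open>p\<^sup>0\<close>. The cofactors are determinants whose entries are
  all \<open>p\<close>-th powers, so they are killed and only the entries \<open>y\<close> of that column are differentiated,
  and each of them becomes \<open>y\<close> to the power \<open>p\<^sup>i\<close>.\<close>

lemma St_scal_ybracket_Cons:
  assumes "0 \<notin> set es"
  shows "St i (scal (ybracket vs (0 # es) :: 'p :: prime_card poly_y)) = scal (ybracket vs (i # es))"
proof -
  let ?m = "Suc (length es)"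
  define A where "A e = mat ?m ?m (\<lambda>(a, b). yvar (vs ! a) ^ (CARD('p) ^ ((e # es) ! b)) :: 'p poly_y)"
    for e
  define C where "C = (\<lambda>a. cofactor (A 0) a 0)"
  have A: "A e \<in> carrier_mat ?m ?m" for e by (simp add: A_def)
  have A0: "A e $$ (a, 0) = yvar (vs ! a) ^ (CARD('p) ^ e)" if "a < ?m" for a e
    using that by (simp add: A_def)
  \<comment> \<open>The first column is deleted in these cofactors, so they do not depend on \<open>e\<close>.\<close>
  have C: "cofactor (A e) a 0 = C a" for a e
    unfolding C_def cofactor_def
    by (intro arg_cong2[of _ _ _ _ "(*)"] arg_cong[of _ _ det] refl eq_matI)
      (auto simp: A_def mat_delete_def)
  have det: "ybracket vs (e # es) = (\<Sum>a<?m. yvar (vs ! a) ^ (CARD('p) ^ e) * C a)" for e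
    unfolding ybracket_def using laplace_expansion_column[OF A, of 0 e] A0 C
    by (simp add: A_def)
  have C0: "St i (scal (C a)) = 0" if "a < ?m" for a
  proof -
    have "St i (scal (det (mat_delete (A 0) a 0))) = 0"
    proof (rule St_scal_det_eq_0)
      fix a' b' assume "a' < length es" "b' < length es"
      moreover from this have "es ! b' > 0"
        using assms nth_mem by (metis gr0I)
      ultimately show "St i (scal (mat_delete (A 0) a 0 $$ (a', b'))) = 0"
        using that by (simp add: A_def mat_delete_def St_scal_yvar_frobenius)
    qed (use mat_delete_carrier[OF A] in simp)
    moreover have "scal (C a) = of_int ((- 1) ^ a) * scal (det (mat_delete (A 0) a 0))"
      unfolding scal_of_int[symmetric] scal_mult[symmetric] by (simp add: C_def cofactor_def)
    ultimately show ?thesis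
      by (simp only: St_of_int_mult mult_zero_right)
  qed
  have "St i (scal (yvar (vs ! a) * C a)) = scal (yvar (vs ! a) ^ (CARD('p) ^ i) * C a)" if "a < ?m" for a
    using C0[OF that] St_Y[of i "vs ! a", where 'p = 'p, unfolded Y_def]
    by (simp add: scal_mult scal_power St_mult)
  then show ?thesis
    unfolding det scal_sum St_sum by (intro sum.cong) auto
qed

section \<open>Rearranging the exponents\<close>

text \<open>A determinant changes sign once for each column that the first column is moved past.\<close>

lemma ybracket_move:
  "ybracket vs (e # es @ fs) = (- 1) ^ length es * ybracket vs (es @ e # fs)"
proof -
  let ?m = "Suc (length es + length fs)"
  let ?A = "mat ?m ?m (\<lambda>(a, b). yvar (vs ! a) ^ CARD('a) ^ (e # es @ fs) ! b) :: 'a poly_y mat"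
  have "det ?A = (- 1) ^ (1 * length es) *
    det (mat ?m ?m (\<lambda>(a, b). ?A $$ (a, if b < length es then b + 1
      else if b < 1 + length es then b - length es else b)))"
    by (rule det_swap_initial_cols) auto
  also have "mat ?m ?m (\<lambda>(a, b). ?A $$ (a, if b < length es then b + 1
      else if b < 1 + length es then b - length es else b)) =
    mat ?m ?m (\<lambda>(a, b). yvar (vs ! a) ^ CARD('a) ^ (es @ e # fs) ! b)"
    by (rule eq_matI) (auto simp: nth_append nth_Cons')
  finally show ?thesis by (simp add: ybracket_def)
qed

lemma ybracket_repeated:
  assumes "e \<in> set es"
  shows "ybracket vs (e # es) = 0"
proof -
  obtain b where b: "b < length es" "es ! b = e"
    using assms by (auto simp: in_set_conv_nth)
  then show ?thesis
    unfolding ybracket_def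
    by (intro det_identical_columns[of _ "length (e # es)" 0 "Suc b"]) (auto intro!: eq_vecI)
qed

section \<open>Mixed brackets\<close>

text \<open>The signs and the monomials in the \<open>x\<^sub>j\<close> in the Laplace expansion do not involve the exponents,
  so each rule for \<open>ybracket\<close> can be applied term by term.\<close>

lemma mixed_bracket_move:
  "mixed_bracket k (e # es @ fs) = (- 1) ^ length es * mixed_bracket k (es @ e # fs)"
proof -
  have "scal (ybracket vs (e # es @ fs)) = of_int ((- 1) ^ length es) * scal (ybracket vs (es @ e # fs) :: 'a poly_y)"
    for vs
    unfolding ybracket_move[of vs e es] scal_of_int[symmetric] scal_mult[symmetric] by simp
  then have "f * scal (ybracket vs (e # es @ fs) :: 'a poly_y) =
      of_int ((- 1) ^ length es) * (f * scal (ybracket vs (es @ e # fs)))" for vs f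
    by (metis mult.assoc mult_of_int_commute)
  then show ?thesis
    unfolding mixed_bracket_def Let_def by (simp add: sum_distrib_left)
qed

lemma mixed_bracket_repeated:
  assumes "e \<in> set es"
  shows "mixed_bracket k (e # es) = 0"
  by (simp add: mixed_bracket_def Let_def ybracket_repeated[OF assms])

lemma St_mixed_bracket:
  "St i (mixed_bracket k es) = (\<Sum>I | I \<subseteq> {1..k + length es} \<and> card I = k.
     of_int (sign (laplace_perm (k + length es) I)) * prod_list (map X (sorted_list_of_set I)) *
     St i (scal (ybracket (sorted_list_of_set ({1..k + length es} - I)) es)))"
  by (simp add: mixed_bracket_def Let_def St_sum mult.assoc St_of_int_mult)
     (simp add: St_mult St_prod_list_X)

lemma St_mixed_bracket_eq_0: "0 \<notin> set es \<Longrightarrow> St i (mixed_bracket k es) = 0"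
  by (simp add: St_mixed_bracket St_scal_ybracket_eq_0)

lemma St_mixed_bracket_Cons:
  "0 \<notin> set es \<Longrightarrow> St i (mixed_bracket k (0 # es)) = mixed_bracket k (i # es)"
  by (simp add: St_mixed_bracket St_scal_ybracket_Cons)
    (simp add: mixed_bracket_def Let_def)

section \<open>The Mui invariants\<close>

lemma L_eq_Mui: "L n = Mui n []"
  by (simp add: L_def Mui_def mixed_bracket_0)

lemma length_filter_notin_upt: "length (filter (\<lambda>e. e \<notin> S) [a..<b]) = card ({a..<b} - S)"
  by (subst distinct_card[symmetric]) (auto intro!: arg_cong[of _ _ card])

lemma filter_Suc_0_upt:
  assumes "0 < n"
  shows "filter Q [0..<n] = (if Q 0 then [0] else []) @ filter Q [1..<n]"
  using assms by (simp add: upt_conv_Cons)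

lemma St_Mui_eq_0:
  assumes "0 \<in> set ss"
  shows "St i (Mui n ss) = 0"
  unfolding Mui_def using assms by (intro St_mixed_bracket_eq_0) auto

lemma St_Mui_eq_mixed_bracket:
  assumes "0 \<notin> set ss" "0 < n"
  shows "St i (Mui n ss) = mixed_bracket (length ss) (i # filter (\<lambda>e. e \<notin> set ss) [1..<n])"
  unfolding Mui_def using assms by (simp add: filter_Suc_0_upt St_mixed_bracket_Cons)

text \<open>If \<open>0\<close> is in the exponent list, it is replaced by the exponent \<open>i\<close>, which the list already
  contains.\<close>

lemma St_Mui_repeated:
  assumes "0 < i" "i < n" "i \<notin> set ss"
  shows "St i (Mui n ss) = 0"
proof (cases "0 \<in> set ss")
  case False
  then show ?thesis
    using assms by (simp add: St_Mui_eq_mixed_bracket mixed_bracket_repeated)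
qed (rule St_Mui_eq_0)

text \<open>Replacing \<open>0\<close> by the omitted exponent \<open>i\<close> leaves an exponent list that now omits \<open>0\<close> and
  contains \<open>i\<close>. To restore the increasing order, \<open>i\<close> has to pass the exponents below it. The list
  \<open>ts\<close> enters only through its elements and its length, so its order is free.\<close>

lemma St_Mui_exchange:
  assumes "0 \<notin> set ss" "0 < i" "i < n" "i \<in> set ss"
    and ts: "set ts = insert 0 (set ss - {i})" "length ts = length ss"
  shows "St i (Mui n ss) = (- 1) ^ card ({1..<i} - set ss) * Mui n ts"
proof -
  let ?l = "filter (\<lambda>e. e \<notin> set ss) [1..<i]" and ?r = "filter (\<lambda>e. e \<notin> set ss) [Suc i..<n]"
  have upt: "[1..<n] = [1..<i] @ i # [Suc i..<n]"
    using assms(2,3) upt_add_eq_append[of 1 i "n - i"] by (simp add: upt_conv_Cons)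
  have "filter (\<lambda>e. e \<notin> set ss) [1..<n] = ?l @ ?r"
    unfolding upt using \<open>i \<in> set ss\<close> by simp
  moreover have "filter (\<lambda>e. e \<notin> set ts) [0..<n] = ?l @ i # ?r"
  proof -
    have "filter (\<lambda>e. e \<notin> set ts) [0..<n] = filter (\<lambda>e. e \<notin> set ts) [1..<n]"
      using assms by (simp add: filter_Suc_0_upt)
    also have "\<dots> = filter (\<lambda>e. e \<notin> set ss \<or> e = i) [1..<n]"
      using ts by (intro filter_cong) auto
    also have "\<dots> = ?l @ i # ?r"
    proof -
      have "filter (\<lambda>e. e \<notin> set ss \<or> e = i) xs = filter (\<lambda>e. e \<notin> set ss) xs"
        if "i \<notin> set xs" for xs
        using that by (intro filter_cong) auto
      then show ?thesis unfolding upt by simp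
    qed
    finally show ?thesis .
  qed
  moreover have "St i (Mui n ss) = mixed_bracket (length ss) (i # filter (\<lambda>e. e \<notin> set ss) [1..<n])"
    using assms by (intro St_Mui_eq_mixed_bracket) auto
  ultimately show ?thesis
    unfolding Mui_def[of n ts] ts(2) length_filter_notin_upt[symmetric]
    by (simp only: mixed_bracket_move)
qed

text \<open>For \<open>i \<ge> n\<close> the increasing order is restored by moving the new exponent \<open>i\<close> past all
  others.\<close>

lemma St_Mui_large:
  assumes "0 \<notin> set ss" "0 < n"
  shows "St i (Mui n ss) = (- 1) ^ card ({1..<n} - set ss) *
    mixed_bracket (length ss) (filter (\<lambda>e. e \<notin> set ss) [1..<n] @ [i])"
  using mixed_bracket_move[of "length ss" i "filter (\<lambda>e. e \<notin> set ss) [1..<n]" "[]"] assms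
  by (simp add: St_Mui_eq_mixed_bracket length_filter_notin_upt)

lemma St_L_eq_0: "0 < i \<Longrightarrow> i < n \<Longrightarrow> St i (L n) = 0"
  by (simp add: L_eq_Mui St_Mui_repeated)

lemma St_L_large:
  "0 < n \<Longrightarrow> St i (L n) = (- 1) ^ (n - 1) * bracket ([1..<n] @ [i])"
  by (simp add: L_eq_Mui St_Mui_large flip: mixed_bracket_0)

text \<open>At \<open>d = 1\<close> the truncated exponent \<open>d - 2\<close> is harmless: its term has the factor \<open>d - 1 = 0\<close>.\<close>

lemma St_Mui_pow:
  "St i (Mui_pow d n ss :: 'p :: prime_card cohom) =
    St i (Mui n ss) * L n ^ (d - 1) + of_nat (d - 1) * Mui n ss * St i (L n) * L n ^ (d - 2)"
proof -
  have "d - 1 - 1 = d - 2" by simp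
  then have "St i (L n ^ (d - 1) :: 'p cohom) = of_nat (d - 1) * St i (L n) * L n ^ (d - 2)"
    unfolding L_def bracket_def by (simp only: St_power_scal)
  moreover have "Mui n ss * of_nat (d - 1) = of_nat (d - 1) * (Mui n ss :: 'p cohom)"
    by (metis mult_of_nat_commute)
  ultimately show ?thesis
    by (simp only: Mui_pow_def St_mult mult.assoc[symmetric])
qed

theorem theorem3p7:
  fixes d i k n :: nat and s :: "nat \<Rightarrow> nat"
  assumes "odd CARD('p :: prime_card)"
    and "1 \<le> d" and "d \<le> CARD('p) - 1"
    and "1 \<le> i"
    and "1 \<le> k"
    and "\<And>a b. 1 \<le> a \<Longrightarrow> a < b \<Longrightarrow> b \<le> k \<Longrightarrow> s a < s b"
    and "s k < n"
    and "s 0 = 0"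
  shows
    "let ss = map s [1..<k + 1];
         M = (Mui n ss :: 'p cohom);
         St_M = (St i (Mui_pow d n ss) :: 'p cohom);
         B = (bracket ([1..<n] @ [i]) :: 'p cohom)
     in
     (\<forall>t\<in>{1..k}. s 1 > 0 \<and> i = s t \<longrightarrow>
        St_M = (- 1) ^ (s t - t) * Mui_pow d n (map s (filter (\<lambda>j. j \<noteq> t) [0..<k + 1]))) \<and>
     (i \<ge> n \<and> s 1 = 0 \<longrightarrow>
        St_M = (- 1) ^ (n - 1) * of_nat (d - 1) * M * B * L n ^ (d - 2)) \<and>
     (i \<ge> n \<and> s 1 > 0 \<longrightarrow>
        St_M = (- 1) ^ (n - 1) *
          ((- 1) ^ k * mixed_bracket k (filter (\<lambda>e. e \<notin> set ss) [1..<n] @ [i]) * L n ^ (d - 1) +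
           of_nat (d - 1) * M * B * L n ^ (d - 2))) \<and>
     (\<not> (s 1 > 0 \<and> (\<exists>t\<in>{1..k}. i = s t)) \<and> \<not> (i \<ge> n \<and> s 1 = 0) \<and> \<not> (i \<ge> n \<and> s 1 > 0) \<longrightarrow>
        St_M = 0)"
proof -
  let ?ss = "map s [1..<k + 1]"
  let ?zs = "filter (\<lambda>e. e \<notin> set ?ss) [1..<n]"
  let ?M = "Mui n ?ss :: 'p cohom"
  have n: "0 < n" using \<open>s k < n\<close> by simp
  have set_ss: "set ?ss = s ` {1..k}" by (auto simp del: upt_Suc)
  have inj: "inj_on s {1..k}"
    using assms(6) by (auto intro!: linorder_inj_onI')  (metis less_irrefl)
  have le: "s a \<le> s b" if "1 \<le> a" "a \<le> b" "b \<le> k" for a b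
    using that assms(6)[of a b] by (cases "a = b") auto
  have bound: "s j < n" if "j \<in> {1..k}" for j
    using le[of j k] that \<open>s k < n\<close> by auto
  have zero: "0 \<in> set ?ss \<longleftrightarrow> s 1 = 0"
    using le[of 1] \<open>1 \<le> k\<close> unfolding set_ss by (force simp: image_iff)
  have exchange: "St i ?M = (- 1) ^ (s t - t) * Mui n (map s (filter (\<lambda>j. j \<noteq> t) [0..<k + 1]))"
    if "s 1 > 0" "t \<in> {1..k}" "i = s t" for t
  proof -
    \<comment> \<open>Below \<open>s t\<close> exactly the \<open>t - 1\<close> exponents \<open>s 1, \<dots>, s (t - 1)\<close> are missing.\<close>
    have "{1..<i} - set ?ss = {1..<s t} - s ` {1..<t}"
    proof -
      have "j < t" if "s j < s t" "j \<in> {1..k}" for j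
        using le[of t j] that \<open>t \<in> {1..k}\<close> by force
      then show ?thesis using \<open>t \<in> {1..k}\<close> \<open>i = s t\<close> unfolding set_ss by auto
    qed
    moreover have "s ` {1..<t} \<subseteq> {1..<s t}"
      using assms(6)[of _ t] le[of 1] \<open>t \<in> {1..k}\<close> \<open>s 1 > 0\<close> by force
    moreover have "card (s ` {1..<t}) = t - 1"
      using \<open>t \<in> {1..k}\<close> by (subst card_image) (auto intro: inj_on_subset[OF inj])
    ultimately have "card ({1..<i} - set ?ss) = s t - 1 - (t - 1)"
      by (simp add: card_Diff_subset)
    also have "\<dots> = s t - t" using \<open>t \<in> {1..k}\<close> by auto
    finally have sign: "card ({1..<i} - set ?ss) = s t - t" .
    let ?ts = "map s (filter (\<lambda>j. j \<noteq> t) [0..<k + 1])"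
    have "set ?ts = s ` ({0..k} - {t})" by (auto simp del: upt_Suc)
    also have "\<dots> = insert 0 (set ?ss - {i})"
    proof -
      have "{0..k} - {t} = insert 0 ({1..k} - {t})" using \<open>t \<in> {1..k}\<close> by auto
      moreover have "s ` ({1..k} - {t}) = s ` {1..k} - {s t}"
        using inj_on_image_set_diff[OF inj, of "{1..k}" "{t}"] \<open>t \<in> {1..k}\<close> by simp
      ultimately show ?thesis
        unfolding set_ss by (simp add: \<open>i = s t\<close> \<open>s 0 = 0\<close>)
    qed
    finally have "set ?ts = insert 0 (set ?ss - {i})" .
    moreover have "length ?ts = length ?ss"
      using length_filter_notin_upt[of "{t}" 0 "k + 1"] \<open>t \<in> {1..k}\<close>
      by (simp add: card_Diff_subset del: upt_Suc)
    moreover have "0 \<notin> set ?ss" "i < n" "i \<in> set ?ss"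
      using zero that bound unfolding set_ss by auto
    ultimately show ?thesis
      using St_Mui_exchange[of ?ss i n ?ts] \<open>1 \<le> i\<close> sign by simp
  qed
  have large: "St i ?M = (- 1) ^ (n - 1) * ((- 1) ^ k * mixed_bracket k (?zs @ [i]))"
    if "s 1 > 0"
  proof -
    have nz: "0 \<notin> set ?ss" using zero that by simp
    moreover have sub: "set ?ss \<subseteq> {1..<n}"
      using bound nz unfolding set_ss by (force simp: Suc_le_eq)
    moreover have card: "card (set ?ss) = k"
      unfolding set_ss using inj by (simp add: card_image)
    moreover have "k \<le> n - 1"
      using card_mono[OF _ sub] card by simp
    moreover from this have "(- 1) ^ (n - 1 - k) = ((- 1) ^ (n - 1) * (- 1) ^ k :: 'p cohom)"
      using n by (auto simp: minus_one_power_iff)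
    ultimately show ?thesis
      using St_Mui_large[of ?ss n i, where 'a = 'p] n by (simp add: card_Diff_subset mult.assoc del: upt_Suc)
  qed
  note St_pow = St_Mui_pow[of i d n ?ss, where 'p = 'p]
  have left_sign: "f * ((- 1) ^ (n - 1) * g) = (- 1) ^ (n - 1) * (f * g)" for f g :: "'p cohom"
    by (cases "even (n - 1)") simp_all
  show ?thesis
    unfolding Let_def
  proof (intro conjI impI ballI)
    fix t assume t: "t \<in> {1..k}" "s 1 > 0 \<and> i = s t"
    with bound have "i < n" by blast
    with t show "St i (Mui_pow d n ?ss :: 'p cohom) =
        (- 1) ^ (s t - t) * Mui_pow d n (map s (filter (\<lambda>j. j \<noteq> t) [0..<k + 1]))"
      using exchange[of t] St_L_eq_0[of i n, where 'a = 'p] \<open>1 \<le> i\<close>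
      unfolding St_pow by (simp add: Mui_pow_def mult.assoc)
  next
    assume "n \<le> i \<and> s 1 = 0"
    then have "St i ?M = 0" using zero by (intro St_Mui_eq_0) simp
    then show "St i (Mui_pow d n ?ss :: 'p cohom) =
        (- 1) ^ (n - 1) * of_nat (d - 1) * ?M * bracket ([1..<n] @ [i]) * L n ^ (d - 2)"
      unfolding St_pow St_L_large[OF n]
      by (simp only: mult_zero_left add_0 left_sign mult.assoc)
  next
    assume "n \<le> i \<and> 0 < s 1"
    then show "St i (Mui_pow d n ?ss :: 'p cohom) =
        (- 1) ^ (n - 1) * ((- 1) ^ k * mixed_bracket k (?zs @ [i]) * L n ^ (d - 1) +
          of_nat (d - 1) * ?M * bracket ([1..<n] @ [i]) * L n ^ (d - 2))"
      unfolding St_pow St_L_large[OF n]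
      by (simp only: large left_sign distrib_left mult.assoc)
  next
    assume other: "\<not> (0 < s 1 \<and> (\<exists>t\<in>{1..k}. i = s t)) \<and> \<not> (n \<le> i \<and> s 1 = 0) \<and> \<not> (n \<le> i \<and> 0 < s 1)"
    then have "i < n" by auto
    moreover from other have "0 \<in> set ?ss \<or> i \<notin> set ?ss"
      unfolding zero set_ss by auto
    ultimately have "St i ?M = 0"
      using St_Mui_eq_0 St_Mui_repeated \<open>1 \<le> i\<close> by (metis zero_less_iff_neq_zero not_one_le_zero)
    then show "St i (Mui_pow d n ?ss :: 'p cohom) = 0"
      using St_L_eq_0[of i n, where 'a = 'p] \<open>1 \<le> i\<close> \<open>i < n\<close> unfolding St_pow by simp
  qed
qed

end
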